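(* Every compactly generated nilpotent locally compact Hausdorff group is polycyclic-by-compact.
   Context: A subgroup $P$ of a topological group $G$ is cocompact if there is a compact subset $K\subseteq G$ with $G=KP$. A group is polycyclic if it has a finite subnormal series with cyclic factors. A group $G$ is polycyclic-by-compact if it has a polycyclic cocompact subgroup (not required to be closed or normal). A group $G$ is nilpotent if there is a finite series $1=G_0\unlhd G_1\unlhd\cdots\unlhd G_r=G$ of normal subgroups with $[G,G_i]\leq G_{i-1}$ for $i=1,\dots,r$. *)

theory Defs
  imports
    "HOL-Analysis.Abstract_Topological_Spaces"
    "HOL-Algebra.Generated_Groups"
    "HOL-Algebra.Elementary_Groups"
begin

locale topological_group = group G
  for G :: "('a, 'b) monoid_scheme" (structure) +
  fixes T :: "'a topology"
  assumes topspace_eq_carrier: "topspace T = carrier G"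
    and continuous_mult: "continuous_map (prod_topology T T) T (\<lambda>(x, y). x \<otimes> y)"
    and continuous_inv: "continuous_map T T (\<lambda>x. inv x)"

text \<open>Generation is meant algebraically, i.e. without taking the closure.\<close>

definition compactly_generated :: "('a, 'b) monoid_scheme \<Rightarrow> 'a topology \<Rightarrow> bool"
  where "compactly_generated G T \<longleftrightarrow> (\<exists>K. compactin T K \<and> generate G K = carrier G)"

definition cocompact_subgroup :: "('a, 'b) monoid_scheme \<Rightarrow> 'a topology \<Rightarrow> 'a set \<Rightarrow> bool"
  where "cocompact_subgroup G T P \<longleftrightarrow>
    subgroup P G \<and> (\<exists>K. compactin T K \<and> carrier G = K <#>\<^bsub>G\<^esub> P)"

definition polycyclic :: "('a, 'b) monoid_scheme \<Rightarrow> bool"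
  where "polycyclic G \<longleftrightarrow>
    group G \<and>
    (\<exists>(n::nat) H. H 0 = {\<one>\<^bsub>G\<^esub>} \<and> H n = carrier G \<and>
      (\<forall>i\<le>n. subgroup (H i) G) \<and>
      (\<forall>i<n. H i \<lhd> G\<lparr>carrier := H (Suc i)\<rparr> \<and>
             cyclic_group (G\<lparr>carrier := H (Suc i)\<rparr> Mod H i)))"

definition polycyclic_by_compact :: "('a, 'b) monoid_scheme \<Rightarrow> 'a topology \<Rightarrow> bool"
  where "polycyclic_by_compact G T \<longleftrightarrow>
    (\<exists>P. cocompact_subgroup G T P \<and> polycyclic (G\<lparr>carrier := P\<rparr>))"

definition commutator_subgroup :: "('a, 'b) monoid_scheme \<Rightarrow> 'a set \<Rightarrow> 'a set \<Rightarrow> 'a set"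
  where "commutator_subgroup G A B =
    generate G {x \<otimes>\<^bsub>G\<^esub> y \<otimes>\<^bsub>G\<^esub> inv\<^bsub>G\<^esub> x \<otimes>\<^bsub>G\<^esub> inv\<^bsub>G\<^esub> y | x y. x \<in> A \<and> y \<in> B}"

definition nilpotent_group :: "('a, 'b) monoid_scheme \<Rightarrow> bool"
  where "nilpotent_group G \<longleftrightarrow>
    group G \<and>
    (\<exists>(r::nat) H. H 0 = {\<one>\<^bsub>G\<^esub>} \<and> H r = carrier G \<and>
      (\<forall>i\<le>r. H i \<lhd> G) \<and>
      (\<forall>i<r. H i \<subseteq> H (Suc i) \<and>
             commutator_subgroup G (carrier G) (H (Suc i)) \<subseteq> H i))"

end

theory Submission
  imports Defs
begin

text \<open>
  Let \<open>Q\<close> be a compact symmetric generating set containing an open neighbourhood \<open>U\<close> of the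
  identity. By compactness \<open>Q Q \<subseteq> U F \<subseteq> Q F\<close> for some finite \<open>F\<close>, hence \<open>Q \<langle>F\<rangle>\<close> is stable under
  left multiplication by \<open>Q\<close> and so is the whole group. Thus \<open>\<langle>F\<rangle>\<close> is a finitely generated
  cocompact subgroup, and a finitely generated nilpotent group is polycyclic: adjoin the iterated
  commutators of the generators one at a time, the longest first. Each of them is central modulo
  the normal subgroup generated by the previous ones.
\<close>

section \<open>Finitely generated nilpotent groups\<close>

lemma (in group) inv_mult_cancel_left:
  "\<lbrakk>x \<in> carrier G; y \<in> carrier G\<rbrakk> \<Longrightarrow> inv x \<otimes> (x \<otimes> y) = y"
  by (simp flip: m_assoc)

section \<open>Cyclic extensions of polycyclic groups\<close>

lemma polycyclic_trivial:
  fixes G (structure)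
  assumes "group G"
  shows "polycyclic (G\<lparr>carrier := {\<one>\<^bsub>G\<^esub>}\<rparr>)"
proof -
  interpret group G by fact
  have 1: "group (G\<lparr>carrier := {\<one>}\<rparr>)"
    using subgroup_imp_group[OF triv_subgroup] .
  show ?thesis
    unfolding polycyclic_def
    using 1 group.triv_subgroup[OF 1]
    by (intro conjI exI[of _ 0] exI[of _ "\<lambda>_. {\<one>}"]) auto
qed

lemma polycyclic_cyclic_extension:
  fixes G (structure)
  assumes N: "N \<lhd> G" and poly: "polycyclic (G\<lparr>carrier := N\<rparr>)" and cyc: "cyclic_group (G Mod N)"
  shows "polycyclic G"
proof -
  interpret normal N G by fact
  obtain n :: nat and H where H: "H 0 = {\<one>}" "H n = N"
      "\<And>i. i \<le> n \<Longrightarrow> subgroup (H i) (G\<lparr>carrier := N\<rparr>)"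
      "\<And>i. i < n \<Longrightarrow> H i \<lhd> G\<lparr>carrier := H (Suc i)\<rparr>"
      "\<And>i. i < n \<Longrightarrow> cyclic_group (G\<lparr>carrier := H (Suc i)\<rparr> Mod H i)"
    using poly unfolding polycyclic_def by auto
  \<comment> \<open>Only the subgroup condition still refers to \<open>N\<close>. Normality and
    cyclicity speak of \<open>H (Suc i)\<close> as ambient group, so they carry over to
    \<open>G\<close> unchanged.\<close>
  have sub: "subgroup (H i) G" if "i \<le> n" for i
    using incl_subgroup[OF subgroup_axioms H(3)[OF that]] .
  \<comment> \<open>The series of \<open>N\<close> keeps the indices up to \<open>n\<close> and the
    whole group is put on top at \<open>Suc n\<close>. The only new factor, at \<open>i = n\<close>,
    is \<open>G Mod N\<close>.\<close>
  show ?thesis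
    unfolding polycyclic_def
  proof (intro conjI exI[of _ "Suc n"] exI[of _ "\<lambda>i. if i \<le> n then H i else carrier G"] allI impI)
    show "group G" by (rule is_group)
  next
    fix i assume "i \<le> Suc n"
    then show "subgroup (if i \<le> n then H i else carrier G) G"
      using sub subgroup_self by auto
  next
    fix i assume "i < Suc n"
    then show "(if i \<le> n then H i else carrier G)
        \<lhd> G\<lparr>carrier := if Suc i \<le> n then H (Suc i) else carrier G\<rparr>"
      using H N by (cases "i = n") auto
  next
    fix i assume "i < Suc n"
    then show "cyclic_group (G\<lparr>carrier := if Suc i \<le> n then H (Suc i) else carrier G\<rparr>
        Mod (if i \<le> n then H i else carrier G))"
      using H cyc by (cases "i = n") auto
  qed (use H in auto)
qed

text \<open>All elements of the coset have the same class modulo \<open>H\<close>, so every word in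
  them and their inverses maps to a power of that single class.\<close>

lemma (in normal) cyclic_FactGroup_if_generated_by_coset:
  assumes c: "c \<in> carrier G" and gen: "generate G (H #> c) = carrier G"
  shows "cyclic_group (G Mod H)"
proof -
  interpret Q: group "G Mod H" by (rule factorgroup_is_group)
  have cQ: "H #> c \<in> carrier (G Mod H)"
    using c by (auto simp: carrier_FactGroup)
  have sub: "H #> c \<subseteq> carrier G"
    using c r_coset_subset_G subset by blast
  have coset: "H #> h = H #> c" if "h \<in> H #> c" for h
    using repr_independence[OF that c subgroup_axioms] by simp
  have "H #> g \<in> generate (G Mod H) {H #> c}" if "g \<in> generate G (H #> c)" for g
    using that
  proof (induction rule: generate.induct)
    case one
    then show ?case
      using generate.one[of "G Mod H" "{H #> c}"] subset by simp
  next
    case (incl h)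
    then show ?case by (simp add: coset generate.incl)
  next
    case (inv h)
    then have h: "h \<in> carrier G" using sub by blast
    have "H #> inv h = inv\<^bsub>G Mod H\<^esub> (H #> h)"
      using h by (simp add: rcos_inv inv_FactGroup carrier_FactGroup)
    also have "\<dots> = inv\<^bsub>G Mod H\<^esub> (H #> c)" using inv coset by simp
    finally show ?case by (simp add: generate.inv)
  next
    case (eng h1 h2)
    then have "h1 \<in> carrier G" "h2 \<in> carrier G" using gen by auto
    then have "H #> (h1 \<otimes> h2) = (H #> h1) \<otimes>\<^bsub>G Mod H\<^esub> (H #> h2)"
      by (simp add: rcos_sum)
    then show ?case using eng.IH by (metis generate.eng)
  qed
  then have "carrier (G Mod H) \<subseteq> generate (G Mod H) {H #> c}"
    using gen by (auto simp: carrier_FactGroup)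
  then have "carrier (G Mod H) = range (\<lambda>n::int. (H #> c) [^]\<^bsub>G Mod H\<^esub> n)"
    using Q.generate_pow[OF cQ] Q.int_pow_closed[OF cQ] by auto
  then show ?thesis
    using Q.cyclic_group cQ by blast
qed

section \<open>Adjoining elements that are central modulo a normal subgroup\<close>

text \<open>The elements commuting with \<open>c\<close> modulo \<open>H\<close> form a subgroup, so
  centrality of \<open>c\<close> modulo \<open>H\<close> can be tested on generators.\<close>

lemma (in normal) commutator_mem_if_generators:
  assumes F: "F \<subseteq> carrier G" "generate G F = carrier G" and c: "c \<in> carrier G"
    and comm: "\<And>x. x \<in> F \<Longrightarrow> x \<otimes> c \<otimes> inv x \<otimes> inv c \<in> H"
    and g: "g \<in> carrier G"
  shows "g \<otimes> c \<otimes> inv g \<otimes> inv c \<in> H"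
proof -
  have "g \<in> generate G F" using F g by simp
  then show ?thesis
  proof (induction rule: generate.induct)
    case one
    then show ?case using c by (simp add: one_closed)
  next
    case (incl h)
    then show ?case by (rule comm)
  next
    case (inv h)
    then have h: "h \<in> carrier G" using F by blast
    \<comment> \<open>With [x, y] = x y x^-1 y^-1, this is the identity [h^-1, c] = h^-1 [h, c]^-1
      h; the conjugate stays in \<open>H\<close> by normality.\<close>
    have "inv h \<otimes> inv (h \<otimes> c \<otimes> inv h \<otimes> inv c) \<otimes> h \<in> H"
      using inv_op_closed1[OF h] comm[OF inv] m_inv_closed by blast
    moreover have "inv h \<otimes> inv (h \<otimes> c \<otimes> inv h \<otimes> inv c) \<otimes> h = inv h \<otimes> c \<otimes> inv (inv h) \<otimes> inv c"
      using h c by (simp add: inv_mult_group m_assoc inv_mult_cancel_left)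
    ultimately show ?case by simp
  next
    case (eng a b)
    then have ab: "a \<in> carrier G" "b \<in> carrier G" using F by auto
    \<comment> \<open>The identity behind this step is [a b, c] = (a [b, c] a^-1) [a, c].\<close>
    have "(a \<otimes> (b \<otimes> c \<otimes> inv b \<otimes> inv c) \<otimes> inv a) \<otimes> (a \<otimes> c \<otimes> inv a \<otimes> inv c) \<in> H"
      using inv_op_closed2[OF ab(1)] eng.IH by blast
    moreover have "(a \<otimes> (b \<otimes> c \<otimes> inv b \<otimes> inv c) \<otimes> inv a) \<otimes> (a \<otimes> c \<otimes> inv a \<otimes> inv c)
        = a \<otimes> b \<otimes> c \<otimes> inv (a \<otimes> b) \<otimes> inv c"
      using ab c by (simp add: inv_mult_group m_assoc inv_mult_cancel_left)
    ultimately show ?case by simp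
  qed
qed

text \<open>Centrality of \<open>c\<close> modulo \<open>H\<close> makes the coset
  \<open>H #> c\<close> stable under conjugation. Hence the subgroup it generates is normal, and it
  is an extension of \<open>H\<close> by the cyclic group generated by the class of
  \<open>c\<close>.\<close>

lemma (in normal) polycyclic_adjoin_central:
  assumes poly: "polycyclic (G\<lparr>carrier := H\<rparr>)" and c: "c \<in> carrier G"
    and comm: "\<And>g. g \<in> carrier G \<Longrightarrow> g \<otimes> c \<otimes> inv g \<otimes> inv c \<in> H"
  obtains M where "M \<lhd> G" "polycyclic (G\<lparr>carrier := M\<rparr>)" "H \<subseteq> M" "c \<in> M"
proof -
  define M where "M = generate G (H #> c)"
  have sub: "H #> c \<subseteq> carrier G"
    using c r_coset_subset_G subset by blast
  have M: "M \<lhd> G"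
    unfolding M_def
  proof (rule normal_generateI[OF sub])
    fix h g assume "h \<in> H #> c" and g: "g \<in> carrier G"
    then obtain n where n: "n \<in> H" "h = n \<otimes> c" by (auto simp: r_coset_def)
    then have nG: "n \<in> carrier G" using subset by blast
    \<comment> \<open>Conjugation by \<open>g\<close> sends n c to (g n g^-1) [g, c] c, where the
      factors before \<open>c\<close> lie in \<open>H\<close>.\<close>
    have "(g \<otimes> n \<otimes> inv g) \<otimes> (g \<otimes> c \<otimes> inv g \<otimes> inv c) \<in> H"
      using comm[OF g] inv_op_closed2[OF g n(1)] by blast
    moreover have "g \<otimes> h \<otimes> inv g
        = ((g \<otimes> n \<otimes> inv g) \<otimes> (g \<otimes> c \<otimes> inv g \<otimes> inv c)) \<otimes> c"
      using n(2) nG g c by (simp add: m_assoc inv_mult_cancel_left)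
    ultimately show "g \<otimes> h \<otimes> inv g \<in> H #> c"
      by (auto simp: r_coset_def)
  qed
  have "c \<in> H #> c" using rcos_self[OF c subgroup_axioms] .
  then have cM: "c \<in> M" by (simp add: M_def generate.incl)
  have Msub: "subgroup M G" using M by (rule normal_imp_subgroup)
  have HM: "H \<subseteq> M"
  proof
    fix n assume n: "n \<in> H"
    then have "n \<otimes> c \<in> M"
      by (auto simp: M_def r_coset_def intro!: generate.incl)
    then have "n \<otimes> c \<otimes> inv c \<in> M"
      using cM Msub by (simp add: subgroup.m_closed subgroup.m_inv_closed)
    then show "n \<in> M" using n c subset by (simp add: m_assoc subsetD)
  qed
  have HnM: "H \<lhd> G\<lparr>carrier := M\<rparr>"
    using normal_restrict_supergroup[OF Msub normal_axioms HM] .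
  have coset: "H #>\<^bsub>G\<lparr>carrier := M\<rparr>\<^esub> c = H #> c" by (simp add: r_coset_def)
  have "generate (G\<lparr>carrier := M\<rparr>) (H #> c) = M"
    using generate_consistent[OF _ Msub, of "H #> c"] by (auto simp: M_def intro: generate.incl)
  then have "cyclic_group (G\<lparr>carrier := M\<rparr> Mod H)"
    using normal.cyclic_FactGroup_if_generated_by_coset[OF HnM, of c] cM coset by simp
  then have "polycyclic (G\<lparr>carrier := M\<rparr>)"
    using polycyclic_cyclic_extension[OF HnM] poly by simp
  with that M HM cM show ?thesis by blast
qed

text \<open>An element central modulo \<open>N\<close> stays central modulo every larger normal
  subgroup, so the elements of \<open>C\<close> can be adjoined one after the other.\<close>

lemma (in group) polycyclic_adjoin_finite_central:
  assumes "finite C" and "N \<lhd> G" "polycyclic (G\<lparr>carrier := N\<rparr>)" and "C \<subseteq> carrier G"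
    and "\<And>g c. \<lbrakk>g \<in> carrier G; c \<in> C\<rbrakk> \<Longrightarrow> g \<otimes> c \<otimes> inv g \<otimes> inv c \<in> N"
  shows "\<exists>M. M \<lhd> G \<and> polycyclic (G\<lparr>carrier := M\<rparr>) \<and> N \<union> C \<subseteq> M"
  using assms
proof (induction C rule: finite_induct)
  case empty
  then show ?case by blast
next
  case (insert c C)
  then obtain M where M: "M \<lhd> G" "polycyclic (G\<lparr>carrier := M\<rparr>)" "N \<union> C \<subseteq> M"
    by auto
  then have "g \<otimes> c \<otimes> inv g \<otimes> inv c \<in> M" if "g \<in> carrier G" for g
    using insert.prems(4)[OF that] by blast
  then obtain L where "L \<lhd> G" "polycyclic (G\<lparr>carrier := L\<rparr>)" "M \<subseteq> L" "c \<in> L"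
    using normal.polycyclic_adjoin_central[OF M(1,2), of c] insert.prems(3) by auto
  then show ?case using M(3) by blast
qed

section \<open>Iterated commutators of a finite generating set\<close>

text \<open>Level \<open>k\<close> holds the right-nested commutators [x1, [x2, ... [xk, y]]] of
  weight exactly \<open>k + 1\<close>, with all entries in \<open>F\<close>.\<close>

fun iterated_commutators :: "('a, 'b) monoid_scheme \<Rightarrow> 'a set \<Rightarrow> nat \<Rightarrow> 'a set" where
  "iterated_commutators G F 0 = F"
| "iterated_commutators G F (Suc k) =
    (\<lambda>(x, y). x \<otimes>\<^bsub>G\<^esub> y \<otimes>\<^bsub>G\<^esub> inv\<^bsub>G\<^esub> x \<otimes>\<^bsub>G\<^esub> inv\<^bsub>G\<^esub> y) ` (F \<times> iterated_commutators G F k)"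

lemma finite_iterated_commutators: "finite F \<Longrightarrow> finite (iterated_commutators G F k)"
  by (induction k) auto

lemma (in group) iterated_commutators_closed:
  "F \<subseteq> carrier G \<Longrightarrow> iterated_commutators G F k \<subseteq> carrier G"
  by (induction k) (auto simp: subset_iff)

theorem polycyclic_if_finitely_generated_nilpotent:
  fixes G (structure)
  assumes nil: "nilpotent_group G" and fin: "finite F" and FG: "F \<subseteq> carrier G"
    and gen: "generate G F = carrier G"
  shows "polycyclic G"
proof -
  interpret group G using nil by (simp add: nilpotent_group_def)
  obtain r :: nat and H where H: "H 0 = {\<one>}" "H r = carrier G"
      "\<And>i. i < r \<Longrightarrow> commutator_subgroup G (carrier G) (H (Suc i)) \<subseteq> H i"
    using nil unfolding nilpotent_group_def by auto
  let ?C = "iterated_commutators G F"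
  \<comment> \<open>Each further commutator descends one step in the central series, starting from
    \<open>H r\<close>; hence level \<open>r\<close> lies in the trivial group
    \<open>H 0\<close>.\<close>
  have CH: "?C k \<subseteq> H (r - k)" if "k \<le> r" for k
    using that
  proof (induction k)
    case 0
    then show ?case using FG H by simp
  next
    case (Suc k)
    then have r: "r - k = Suc (r - Suc k)" "r - Suc k < r" by auto
    have "x \<otimes> y \<otimes> inv x \<otimes> inv y \<in> commutator_subgroup G (carrier G) (H (Suc (r - Suc k)))"
      if "x \<in> F" "y \<in> ?C k" for x y
      unfolding commutator_subgroup_def using that Suc FG r by (intro generate.incl) auto
    then show ?case using H(3)[OF r(2)] by auto
  qed
  \<comment> \<open>Descending induction from \<open>k = r\<close>, where the trivial subgroup
    serves as \<open>N\<close>, down to \<open>k = 0\<close>, where \<open>N\<close> contains the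
    generators.\<close>
  have "\<exists>N. N \<lhd> G \<and> polycyclic (G\<lparr>carrier := N\<rparr>) \<and> ?C k \<subseteq> N" if "k \<le> r" for k
    using that
  proof (induction rule: inc_induct)
    case base
    then show ?case
      using CH[of r] H(1) one_is_normal polycyclic_trivial[OF is_group] by auto
  next
    case (step k)
    then obtain N where N: "N \<lhd> G" "polycyclic (G\<lparr>carrier := N\<rparr>)" "?C (Suc k) \<subseteq> N" by blast
    \<comment> \<open>For \<open>g\<close> in \<open>F\<close> the commutator belongs to level
      \<open>Suc k\<close> and so to \<open>N\<close>; arbitrary \<open>g\<close> reduce to this
      case because \<open>F\<close> generates \<open>G\<close>.\<close>
    have comm: "g \<otimes> c \<otimes> inv g \<otimes> inv c \<in> N" if "g \<in> carrier G" "c \<in> ?C k" for g c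
    proof (rule normal.commutator_mem_if_generators[OF N(1) FG gen _ _ that(1)])
      show "c \<in> carrier G" using that(2) iterated_commutators_closed[OF FG] by blast
    next
      fix x assume "x \<in> F"
      then show "x \<otimes> c \<otimes> inv x \<otimes> inv c \<in> N" using that(2) N(3) by force
    qed
    have "\<exists>M. M \<lhd> G \<and> polycyclic (G\<lparr>carrier := M\<rparr>) \<and> N \<union> ?C k \<subseteq> M"
      by (rule polycyclic_adjoin_finite_central[OF finite_iterated_commutators[OF fin] N(1,2)
            iterated_commutators_closed[OF FG] comm])
    then show ?case by auto
  qed
  from this[of 0] obtain N where N: "N \<lhd> G" "polycyclic (G\<lparr>carrier := N\<rparr>)" "F \<subseteq> N"
    by auto
  then have "N = carrier G"
    using generate_subgroup_incl[OF N(3) normal_imp_subgroup[OF N(1)]] gen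
      subgroup.subset[OF normal_imp_subgroup[OF N(1)]] by blast
  with N show ?thesis by simp
qed

text \<open>The central series of \<open>G\<close> is intersected with \<open>P\<close>: commutators
  of elements of \<open>P\<close> stay in \<open>P\<close>, and the series of \<open>G\<close> puts
  them one step lower.\<close>

lemma nilpotent_group_subgroup:
  fixes G (structure)
  assumes nil: "nilpotent_group G" and P: "subgroup P G"
  shows "nilpotent_group (G\<lparr>carrier := P\<rparr>)"
proof -
  interpret group G using nil by (simp add: nilpotent_group_def)
  obtain r :: nat and H where H: "H 0 = {\<one>}" "H r = carrier G" "\<And>i. i \<le> r \<Longrightarrow> H i \<lhd> G"
      "\<And>i. i < r \<Longrightarrow> H i \<subseteq> H (Suc i)"
      "\<And>i. i < r \<Longrightarrow> commutator_subgroup G (carrier G) (H (Suc i)) \<subseteq> H i"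
    using nil unfolding nilpotent_group_def by auto
  have grp: "group (G\<lparr>carrier := P\<rparr>)" using subgroup_imp_group[OF P] .
  have nor: "H i \<inter> P \<lhd> G\<lparr>carrier := P\<rparr>" if "i \<le> r" for i
    using normal_Int_subgroup[OF P H(3)[OF that]] .
  have "commutator_subgroup (G\<lparr>carrier := P\<rparr>) P (H (Suc i) \<inter> P) \<subseteq> H i \<inter> P" if i: "i < r" for i
    unfolding commutator_subgroup_def
  proof (rule group.generate_subgroup_incl[OF grp _ normal_imp_subgroup[OF nor]])
    have "x \<otimes> y \<otimes> inv x \<otimes> inv y \<in> H i" if "x \<in> P" "y \<in> H (Suc i)" for x y
    proof -
      have "x \<otimes> y \<otimes> inv x \<otimes> inv y \<in> commutator_subgroup G (carrier G) (H (Suc i))"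
        unfolding commutator_subgroup_def using that subgroup.subset[OF P]
        by (intro generate.incl) blast
      then show ?thesis using H(5)[OF i] by blast
    qed
    then show "{x \<otimes>\<^bsub>G\<lparr>carrier := P\<rparr>\<^esub> y \<otimes>\<^bsub>G\<lparr>carrier := P\<rparr>\<^esub> inv\<^bsub>G\<lparr>carrier := P\<rparr>\<^esub> x
        \<otimes>\<^bsub>G\<lparr>carrier := P\<rparr>\<^esub> inv\<^bsub>G\<lparr>carrier := P\<rparr>\<^esub> y |x y. x \<in> P \<and> y \<in> H (Suc i) \<inter> P} \<subseteq> H i \<inter> P"
      using P by (auto simp: m_inv_consistent subgroup.m_closed subgroup.m_inv_closed)
  qed (use i in simp)
  then show ?thesis
    unfolding nilpotent_group_def
    using grp nor H subgroup.one_closed[OF P] subgroup.subset[OF P]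
    by (intro conjI exI[of _ r] exI[of _ "\<lambda>i. H i \<inter> P"]) (auto dest: H(4))
qed

section \<open>A finitely generated cocompact subgroup\<close>

context topological_group
begin

lemma compactin_set_mult:
  assumes "compactin T A" "compactin T B"
  shows "compactin T (A <#> B)"
proof -
  have "A <#> B = (\<lambda>(x, y). x \<otimes> y) ` (A \<times> B)"
    by (auto simp: set_mult_def)
  moreover have "compactin (prod_topology T T) (A \<times> B)"
    using assms by (simp add: compactin_Times)
  ultimately show ?thesis
    using image_compactin[OF _ continuous_mult] by simp
qed

text \<open>The translate is the preimage of \<open>U\<close> under the continuous map that
  multiplies by \<open>inv g\<close> on the right.\<close>

lemma openin_r_coset:
  assumes U: "openin T U" and g: "g \<in> carrier G"
  shows "openin T (U #> g)"
proof -
  have UG: "U \<subseteq> carrier G"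
    using openin_subset[OF U] topspace_eq_carrier by simp
  have "continuous_map T (prod_topology T T) (\<lambda>x. (x, inv g))"
    using g by (intro continuous_map_pairedI) (auto simp: topspace_eq_carrier)
  from continuous_map_compose[OF this continuous_mult]
  have "continuous_map T T (\<lambda>x. x \<otimes> inv g)"
    by (simp add: comp_def)
  from openin_continuous_map_preimage[OF this U]
  have "openin T {x \<in> carrier G. x \<otimes> inv g \<in> U}"
    by (simp add: topspace_eq_carrier)
  also have "{x \<in> carrier G. x \<otimes> inv g \<in> U} = U #> g"
  proof (intro equalityI subsetI)
    fix x assume "x \<in> {x \<in> carrier G. x \<otimes> inv g \<in> U}"
    then show "x \<in> U #> g"
      using g by (auto simp: r_coset_def m_assoc intro!: bexI[of _ "x \<otimes> inv g"])
  next
    fix x assume "x \<in> U #> g"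
    then show "x \<in> {x \<in> carrier G. x \<otimes> inv g \<in> U}"
      using g UG by (auto simp: r_coset_def m_assoc subset_iff)
  qed
  finally show ?thesis .
qed

text \<open>Since \<open>U\<close> contains the identity, its open right translates cover the group;
  compactness leaves finitely many of them.\<close>

lemma compactin_subset_finite_translates:
  assumes K: "compactin T K" and U: "openin T U" "\<one> \<in> U"
  obtains F where "finite F" "F \<subseteq> carrier G" "K \<subseteq> U <#> F"
proof -
  have "K \<subseteq> carrier G"
    using compactin_subset_topspace[OF K] topspace_eq_carrier by simp
  moreover have "g \<in> U #> g" if "g \<in> carrier G" for g
    using that U(2) by (force simp: r_coset_def)
  ultimately have "K \<subseteq> \<Union> ((\<lambda>g. U #> g) ` carrier G)" by blast
  moreover have "\<And>V. V \<in> (\<lambda>g. U #> g) ` carrier G \<Longrightarrow> openin T V"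
    using openin_r_coset[OF U(1)] by blast
  ultimately obtain \<F> where "finite \<F>" "\<F> \<subseteq> (\<lambda>g. U #> g) ` carrier G" "K \<subseteq> \<Union> \<F>"
    using compactinD[OF K] by metis
  then obtain F where "finite F" "F \<subseteq> carrier G" "K \<subseteq> \<Union> ((\<lambda>g. U #> g) ` F)"
    using finite_subset_image by metis
  then show ?thesis
    using that[of F] by (fastforce simp: r_coset_def set_mult_def)
qed

theorem finitely_generated_cocompact_subgroup:
  assumes lc: "locally_compact_space T" and cg: "compactly_generated G T"
  obtains F where "finite F" "F \<subseteq> carrier G" "cocompact_subgroup G T (generate G F)"
proof -
  obtain K where K: "compactin T K" "generate G K = carrier G"
    using cg unfolding compactly_generated_def by blast
  obtain U W where UW: "openin T U" "compactin T W" "\<one> \<in> U" "U \<subseteq> W"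
    using lc unfolding locally_compact_space_def topspace_eq_carrier by blast
  \<comment> \<open>\<open>K\<close> and its inverses supply every letter of a word over
    \<open>K\<close>; the compact neighbourhood \<open>W\<close> puts \<open>U\<close>, and so the
    identity, inside \<open>Q\<close>.\<close>
  define Q where "Q = K \<union> W \<union> (\<lambda>x. inv x) ` K"
  have Q: "compactin T Q"
    unfolding Q_def using K(1) UW(2) image_compactin[OF K(1) continuous_inv]
    by (intro compactin_Un) auto
  have QG: "Q \<subseteq> carrier G"
    using compactin_subset_topspace[OF Q] topspace_eq_carrier by simp
  obtain F where F: "finite F" "F \<subseteq> carrier G" "Q <#> Q \<subseteq> U <#> F"
    using compactin_subset_finite_translates[OF compactin_set_mult[OF Q Q] UW(1,3)] .
  define P where "P = generate G F"
  have P: "subgroup P G" unfolding P_def by (rule generate_is_subgroup[OF F(2)])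
  have PG: "P \<subseteq> carrier G" by (rule subgroup.subset[OF P])
  have stable: "q \<otimes> x \<in> Q <#> P" if q: "q \<in> Q" and x: "x \<in> Q <#> P" for q x
  proof -
    obtain q' p where p: "q' \<in> Q" "p \<in> P" "x = q' \<otimes> p"
      using x by (auto simp: set_mult_def)
    \<comment> \<open>A product of two elements of \<open>Q\<close> is rewritten as u f:
      \<open>u\<close> is again in \<open>Q\<close>, and \<open>f\<close> is absorbed by
      \<open>P\<close>.\<close>
    have "q \<otimes> q' \<in> U <#> F" using F(3) q p(1) unfolding set_mult_def by blast
    then obtain u f where u: "u \<in> U" "f \<in> F" "q \<otimes> q' = u \<otimes> f"
      unfolding set_mult_def by blast
    have "u \<in> Q" using u(1) UW(4) by (auto simp: Q_def)
    moreover have "f \<otimes> p \<in> P"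
      using u(2) p(2) P by (simp add: P_def generate.incl subgroup.m_closed)
    moreover have "q \<otimes> x = u \<otimes> (f \<otimes> p)"
    proof -
      have "q \<otimes> x = (q \<otimes> q') \<otimes> p"
        using p q QG PG by (simp add: m_assoc subsetD)
      also have "\<dots> = u \<otimes> (f \<otimes> p)"
        using u p \<open>u \<in> Q\<close> F(2) QG PG by (simp add: m_assoc subsetD)
      finally show ?thesis .
    qed
    ultimately show ?thesis by (auto simp: set_mult_def)
  qed
  have QP: "Q <#> P \<subseteq> carrier G" using QG PG by (rule set_mult_closed)
  \<comment> \<open>\<open>x\<close> stays arbitrary in the induction: for a product of
    \<open>a\<close> and \<open>b\<close>, the hypothesis for \<open>a\<close> is applied to the
    point already moved by \<open>b\<close>.\<close>
  have all: "g \<otimes> x \<in> Q <#> P" if "g \<in> generate G K" "x \<in> Q <#> P" for g x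
    using that
  proof (induction arbitrary: x rule: generate.induct)
    case one
    then show ?case using QP by auto
  next
    case (incl h)
    then show ?case using stable by (simp add: Q_def)
  next
    case (inv h)
    then show ?case using stable by (simp add: Q_def)
  next
    case (eng a b)
    then have "a \<in> carrier G" "b \<in> carrier G" "x \<in> carrier G" using K(2) QP by auto
    then show ?case using eng by (simp add: m_assoc)
  qed
  have "\<one> \<in> Q" using UW by (auto simp: Q_def)
  then have "\<one> \<in> Q <#> P"
    using subgroup.one_closed[OF P] by (force simp: set_mult_def)
  \<comment> \<open>Every group element is its own product with the identity, a point of the stable
    set.\<close>
  then have "carrier G \<subseteq> Q <#> P"
    using all[of _ \<one>] K(2) by auto
  then have "cocompact_subgroup G T P"
    unfolding cocompact_subgroup_def using P Q QP by blast
  then show ?thesis using that F(1,2) by (simp add: P_def)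
qed

end

theorem lemma19:
  fixes G :: "('a, 'b) monoid_scheme" and T :: "'a topology"
  assumes "topological_group G T"
    and "locally_compact_space T"
    and "Hausdorff_space T"
    and "compactly_generated G T"
    and "nilpotent_group G"
  shows "polycyclic_by_compact G T"
proof -
  interpret topological_group G T by fact
  obtain F where F: "finite F" "F \<subseteq> carrier G" and coc: "cocompact_subgroup G T (generate G F)"
    using finitely_generated_cocompact_subgroup assms by blast
  have sub: "subgroup (generate G F) G"
    by (rule generate_is_subgroup[OF F(2)])
  \<comment> \<open>\<open>F\<close> also generates this subgroup when the subgroup is taken as the
    ambient group, and nilpotency is inherited from \<open>G\<close>.\<close>
  have "polycyclic (G\<lparr>carrier := generate G F\<rparr>)"
    using F generate_consistent[OF _ sub, of F] generate.incl[of _ F G]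
    by (intro polycyclic_if_finitely_generated_nilpotent[of _ F]
        nilpotent_group_subgroup[OF \<open>nilpotent_group G\<close> sub]) auto
  with coc show ?thesis
    unfolding polycyclic_by_compact_def by blast
qed

end
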